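(* Let $K$ be a field of characteristic $0$ and let $n\geq 1$. Every triangulable polynomial automorphism $F:K^n\to K^n$ is nice.
   Context: $K$ is a field of characteristic $0$. A polynomial map $F=(F_1,\dots,F_n):K^n\to K^n$ is a map whose components $F_i$ are in the polynomial ring $K[X_1,\dots,X_n]$; it is a polynomial automorphism if it has a polynomial inverse. A polynomial map is triangular if it has the form $F_i=X_i+H_i(X_{i+1},\dots,X_n)$ for $1\leq i\leq n-1$ and $F_n=X_n$, with $H_i\in K[X_{i+1},\dots,X_n]$. A polynomial automorphism $F$ is triangulable if there exists $T\in\operatorname{GL}(n,K)$ (viewed as a linear map of $K^n$) such that $T^{-1}\circ F\circ T$ is triangular. Given a polynomial map $F$, define for $i=1,\dots,n$ the polynomials $P_0^i=X_i$ and, for $k\geq 1$, $P_k^i(X_1,\dots,X_n)=P_{k-1}^i(F_1,\dots,F_n)-P_{k-1}^i(X_1,\dots,X_n)$. The map $F$ is called nice if there exists an integer $m$ such that $P_m^i=0$ for all $i=1,\dots,n$. *)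

theory Defs
  imports "Jordan_Normal_Form.Matrix" "HOL-Library.Poly_Mapping"
begin

(* Formal polynomials in variables indexed by nat: finitely supported maps from exponent
   vectors to coefficients.  K[X_1,...,X_n] is the set of those p with vars p \<subseteq> {..<n};
   the variables are numbered from 0, so Var i is X_(i+1). *)

type_synonym 'a mpoly = "(nat \<Rightarrow>\<^sub>0 nat) \<Rightarrow>\<^sub>0 'a"

definition Const :: "'a::comm_ring_1 \<Rightarrow> 'a mpoly" where
  "Const c = Poly_Mapping.single 0 c"

definition Var :: "nat \<Rightarrow> 'a::comm_ring_1 mpoly" where
  "Var i = Poly_Mapping.single (Poly_Mapping.single i 1) 1"

definition vars :: "'a::comm_ring_1 mpoly \<Rightarrow> nat set" where
  "vars p = (\<Union>m\<in>Poly_Mapping.keys p. Poly_Mapping.keys m)"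

definition subst_poly :: "'a::comm_ring_1 mpoly vec \<Rightarrow> 'a mpoly \<Rightarrow> 'a mpoly" where
  "subst_poly F p = (\<Sum>m\<in>Poly_Mapping.keys p. Const (Poly_Mapping.lookup p m) *
     (\<Prod>i\<in>Poly_Mapping.keys m. (F $ i) ^ Poly_Mapping.lookup m i))"

(* A polynomial map is represented by its components.  Over an infinite field, in particular
   in characteristic 0, the components are determined by the induced function on K^n. *)

definition polynomial_map :: "nat \<Rightarrow> 'a::comm_ring_1 mpoly vec \<Rightarrow> bool" where
  "polynomial_map n F \<longleftrightarrow> F \<in> carrier_vec n \<and> (\<forall>i<n. vars (F $ i) \<subseteq> {..<n})"

definition poly_map_id :: "nat \<Rightarrow> 'a::comm_ring_1 mpoly vec" where
  "poly_map_id n = vec n Var"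

(* The composite x \<mapsto> F (G x). *)

definition poly_map_comp :: "'a::comm_ring_1 mpoly vec \<Rightarrow> 'a mpoly vec \<Rightarrow> 'a mpoly vec" where
  "poly_map_comp F G = vec (dim_vec F) (\<lambda>i. subst_poly G (F $ i))"

definition polynomial_automorphism :: "nat \<Rightarrow> 'a::comm_ring_1 mpoly vec \<Rightarrow> bool" where
  "polynomial_automorphism n F \<longleftrightarrow> polynomial_map n F \<and>
     (\<exists>G. polynomial_map n G \<and> poly_map_comp F G = poly_map_id n \<and> poly_map_comp G F = poly_map_id n)"

definition linear_map :: "'a::comm_ring_1 mat \<Rightarrow> 'a mpoly vec" where
  "linear_map A = vec (dim_row A) (\<lambda>i. \<Sum>j<dim_col A. Const (A $$ (i, j)) * Var j)"

definition triangular :: "nat \<Rightarrow> 'a::comm_ring_1 mpoly vec \<Rightarrow> bool" where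
  "triangular n F \<longleftrightarrow> F \<in> carrier_vec n \<and>
     (\<forall>i. i + 1 < n \<longrightarrow> (\<exists>H. vars H \<subseteq> {i<..<n} \<and> F $ i = Var i + H)) \<and>
     F $ (n - 1) = Var (n - 1)"

(* S is the inverse matrix of T, so T ranges over GL(n,K). *)

definition triangulable :: "nat \<Rightarrow> 'a::comm_ring_1 mpoly vec \<Rightarrow> bool" where
  "triangulable n F \<longleftrightarrow> polynomial_automorphism n F \<and>
     (\<exists>T S. T \<in> carrier_mat n n \<and> S \<in> carrier_mat n n \<and> inverts_mat T S \<and> inverts_mat S T \<and>
        triangular n (poly_map_comp (linear_map S) (poly_map_comp F (linear_map T))))"

(* P_poly F i k is the polynomial P_k with superscript i. *)

primrec P_poly :: "'a::comm_ring_1 mpoly vec \<Rightarrow> nat \<Rightarrow> nat \<Rightarrow> 'a mpoly" where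
  "P_poly F i 0 = Var i"
| "P_poly F i (Suc k) = subst_poly F (P_poly F i k) - P_poly F i k"

definition nice :: "nat \<Rightarrow> 'a::comm_ring_1 mpoly vec \<Rightarrow> bool" where
  "nice n F \<longleftrightarrow> (\<exists>m. \<forall>i<n. P_poly F i m = 0)"

end

theory Submission
  imports Defs
begin

text \<open>Composition with a polynomial map \<open>F\<close> is an algebra endomorphism \<open>\<phi>\<^sub>F\<close>, and
  \<open>P\<^sub>k\<^sup>i = D\<^sub>F\<^sup>k X\<^sub>i\<close> for the difference operator \<open>D\<^sub>F = \<phi>\<^sub>F - id\<close>. The twisted Leibniz rule
  \<open>D(pq) = D p \<cdot> q + \<phi> p \<cdot> D q\<close> shows that the polynomials annihilated by some power of
  \<open>D\<^sub>F\<close> form a subalgebra. For triangular \<open>G\<close> it contains all variables, by descending induction,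
  as \<open>D\<^sub>G X\<^sub>i = H\<^sub>i\<close> involves later variables only. A linear change of coordinates intertwines
  \<open>D\<^sub>F\<close> with \<open>D\<^sub>G\<close> and so transports this local nilpotency to \<open>F\<close>.\<close>

subsection \<open>Substitution is an algebra homomorphism\<close>

lemma Const_0 [simp]: "Const 0 = 0"
  by (simp add: Const_def)

lemma Const_1 [simp]: "Const 1 = 1"
  by (simp add: Const_def single_one)

lemma Const_add: "Const (a + b) = Const a + Const b"
  by (simp add: Const_def single_add)

lemma Const_mult: "Const (a * b) = Const a * Const b"
  by (simp add: Const_def mult_single)

lemma Const_sum: "Const (sum f A) = (\<Sum>x\<in>A. Const (f x))"
  by (induction A rule: infinite_finite_induct) (simp_all add: Const_add)

lemma Var_power: "Var i ^ k = Poly_Mapping.single (Poly_Mapping.single i k) (1::'a::comm_ring_1)"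
proof (induction k)
  case (Suc k)
  then show ?case
    by (simp add: Var_def mult_single flip: single_add)
qed (simp add: single_one)

lemma prod_single_1:
  "(\<Prod>x\<in>A. Poly_Mapping.single (f x) (1::'a::comm_ring_1)) = Poly_Mapping.single (\<Sum>x\<in>A. f x) 1"
  by (induction A rule: infinite_finite_induct) (simp_all add: single_one mult_single)

lemma sum_single_lookup:
  "(\<Sum>m\<in>Poly_Mapping.keys p. Poly_Mapping.single m (Poly_Mapping.lookup p m)) = p"
  by (rule poly_mapping_eqI) (simp add: lookup_sum lookup_single when_def in_keys_iff)

lemma single_eq_Const_mult_Var:
  "Poly_Mapping.single m (c::'a::comm_ring_1) =
     Const c * (\<Prod>i\<in>Poly_Mapping.keys m. Var i ^ Poly_Mapping.lookup m i)"
  by (simp add: Var_power prod_single_1 sum_single_lookup Const_def mult_single)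

text \<open>Expanding \<open>p\<close> into terms writes it by sums and products from constants and
  the variables in \<open>V\<close>. It lets two algebra homomorphisms be compared on variables
  alone.\<close>

lemma mpoly_vars_induct [consumes 1, case_names Const Var add mult]:
  fixes p :: "'a::comm_ring_1 mpoly"
  assumes vars: "vars p \<subseteq> V"
    and Const: "\<And>c. P (Const c)"
    and Var: "\<And>i. i \<in> V \<Longrightarrow> P (Var i)"
    and add: "\<And>p q. P p \<Longrightarrow> P q \<Longrightarrow> P (p + q)"
    and mult: "\<And>p q. P p \<Longrightarrow> P q \<Longrightarrow> P (p * q)"
  shows "P p"
proof -
  have zero: "P 0" and one: "P 1"
    using Const[of 0] Const[of 1] by simp_all
  have power: "P (q ^ k)" if "P q" for q k
    by (induction k) (auto intro: that one mult)
  have prod: "P (\<Prod>x\<in>A. f x)" if "\<And>x. x \<in> A \<Longrightarrow> P (f x)" for f and A :: "nat set"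
    using that by (induction A rule: infinite_finite_induct) (auto intro: one mult)
  have sum: "P (\<Sum>x\<in>A. f x)" if "\<And>x. x \<in> A \<Longrightarrow> P (f x)" for f and A :: "(nat \<Rightarrow>\<^sub>0 nat) set"
    using that by (induction A rule: infinite_finite_induct) (auto intro: zero add)
  have "P (\<Sum>m\<in>Poly_Mapping.keys p. Poly_Mapping.single m (Poly_Mapping.lookup p m))"
    using vars unfolding single_eq_Const_mult_Var vars_def
    by (intro sum mult Const prod power Var) auto
  then show ?thesis
    by (simp only: sum_single_lookup)
qed

definition monom_eval :: "'a::comm_ring_1 mpoly vec \<Rightarrow> (nat \<Rightarrow>\<^sub>0 nat) \<Rightarrow> 'a mpoly" where
  "monom_eval F m = (\<Prod>i\<in>Poly_Mapping.keys m. (F $ i) ^ Poly_Mapping.lookup m i)"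

text \<open>Allows one common index set for several exponent vectors: each added factor is a zeroth
  power, hence 1.\<close>

lemma monom_eval_superset:
  assumes "finite A" "Poly_Mapping.keys m \<subseteq> A"
  shows "monom_eval F m = (\<Prod>i\<in>A. (F $ i) ^ Poly_Mapping.lookup m i)"
  unfolding monom_eval_def using assms
  by (intro prod.mono_neutral_left) (auto simp: in_keys_iff)

lemma monom_eval_add: "monom_eval F (m + m') = monom_eval F m * monom_eval F m'"
proof -
  let ?A = "Poly_Mapping.keys m \<union> Poly_Mapping.keys m'"
  have "monom_eval F (m + m') = (\<Prod>i\<in>?A. (F $ i) ^ Poly_Mapping.lookup (m + m') i)"
    by (intro monom_eval_superset keys_add) auto
  then show ?thesis
    using monom_eval_superset[of ?A m F] monom_eval_superset[of ?A m' F]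
    by (simp add: lookup_add power_add prod.distrib)
qed

text \<open>Cancellation can make the keys of a sum smaller than the union of the keys of its
  summands. Summing over a larger set only adds terms with coefficient 0.\<close>

lemma subst_poly_superset:
  assumes "finite A" "Poly_Mapping.keys p \<subseteq> A"
  shows "subst_poly F p = (\<Sum>m\<in>A. Const (Poly_Mapping.lookup p m) * monom_eval F m)"
  unfolding subst_poly_def monom_eval_def[symmetric] using assms
  by (intro sum.mono_neutral_left) (auto simp: in_keys_iff)

lemma subst_poly_0 [simp]: "subst_poly F 0 = 0"
  by (simp add: subst_poly_def)

lemma subst_poly_add: "subst_poly F (p + q) = subst_poly F p + subst_poly F q"
proof -
  let ?A = "Poly_Mapping.keys p \<union> Poly_Mapping.keys q"
  have "subst_poly F (p + q) = (\<Sum>m\<in>?A. Const (Poly_Mapping.lookup (p + q) m) * monom_eval F m)"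
    by (intro subst_poly_superset keys_add) auto
  then show ?thesis
    using subst_poly_superset[of ?A p F] subst_poly_superset[of ?A q F]
    by (simp add: lookup_add Const_add distrib_right sum.distrib)
qed

lemma subst_poly_minus: "subst_poly F (- p) = - subst_poly F p"
  using subst_poly_add[of F p "- p"] by (simp add: eq_neg_iff_add_eq_0 add.commute)

lemma subst_poly_diff: "subst_poly F (p - q) = subst_poly F p - subst_poly F q"
  using subst_poly_add[of F p "- q"] by (simp add: subst_poly_minus)

lemma subst_poly_sum: "subst_poly F (sum f A) = (\<Sum>x\<in>A. subst_poly F (f x))"
  by (induction A rule: infinite_finite_induct) (simp_all add: subst_poly_add)

lemma subst_poly_single: "subst_poly F (Poly_Mapping.single m c) = Const c * monom_eval F m"
  using subst_poly_superset[of "{m}" "Poly_Mapping.single m c" F] by simp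

lemma subst_poly_Const [simp]: "subst_poly F (Const c) = Const c"
  by (simp add: Const_def[of c] subst_poly_single) (simp add: Const_def monom_eval_def)

lemma subst_poly_Var [simp]: "subst_poly F (Var i) = F $ i"
  by (simp add: Var_def subst_poly_single monom_eval_def)

text \<open>Bilinearity reduces the claim to single terms, where it is
  \<open>monom_eval_add\<close>.\<close>

lemma subst_poly_mult: "subst_poly F (p * q) = subst_poly F p * subst_poly F q"
proof -
  let ?s = "\<lambda>p m. Poly_Mapping.single m (Poly_Mapping.lookup p m)"
  have "p * q = (\<Sum>m\<in>Poly_Mapping.keys p. ?s p m) * (\<Sum>m\<in>Poly_Mapping.keys q. ?s q m)"
    by (simp only: sum_single_lookup)
  also have "\<dots> = (\<Sum>m\<in>Poly_Mapping.keys p. \<Sum>m'\<in>Poly_Mapping.keys q. ?s p m * ?s q m')"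
    by (rule sum_product)
  also have "subst_poly F \<dots> =
      (\<Sum>m\<in>Poly_Mapping.keys p. \<Sum>m'\<in>Poly_Mapping.keys q.
        subst_poly F (?s p m) * subst_poly F (?s q m'))"
    by (simp add: subst_poly_sum mult_single subst_poly_single monom_eval_add Const_mult ac_simps)
  also have "\<dots> = subst_poly F (\<Sum>m\<in>Poly_Mapping.keys p. ?s p m) *
      subst_poly F (\<Sum>m\<in>Poly_Mapping.keys q. ?s q m)"
    by (simp only: subst_poly_sum sum_product)
  finally show ?thesis
    by (simp only: sum_single_lookup)
qed

subsection \<open>Variables\<close>

lemma vars_Const [simp]: "vars (Const c) = {}"
  by (simp add: vars_def Const_def)

lemma vars_Var [simp]: "vars (Var i :: 'a::comm_ring_1 mpoly) = {i}"
  by (simp add: vars_def Var_def)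

lemma vars_add: "vars (p + q) \<subseteq> vars p \<union> vars q"
  using keys_add[of p q] by (fastforce simp: vars_def)

lemma vars_diff: "vars (p - q) \<subseteq> vars p \<union> vars q"
  using keys_diff[of p q] by (fastforce simp: vars_def)

lemma vars_mult: "vars (p * q) \<subseteq> vars p \<union> vars q"
  using keys_mult[of p q] keys_add by (fastforce simp: vars_def)

lemma vars_sum: "vars (sum f A) \<subseteq> (\<Union>x\<in>A. vars (f x))"
proof (induction A rule: infinite_finite_induct)
  case (insert x A)
  then show ?case
    using vars_add[of "f x" "sum f A"] by auto
qed (simp_all add: vars_def)

text \<open>Keeps substituted polynomials within the first \<open>n\<close> variables; entries of a
  vector beyond its dimension are unspecified.\<close>

lemma vars_subst_poly:
  assumes "vars p \<subseteq> V" "\<And>i. i \<in> V \<Longrightarrow> vars (F $ i) \<subseteq> W"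
  shows "vars (subst_poly F p) \<subseteq> W"
  using assms(1)
proof (induction p rule: mpoly_vars_induct)
  case (add p q)
  then show ?case
    using vars_add[of "subst_poly F p" "subst_poly F q"] by (auto simp: subst_poly_add)
next
  case (mult p q)
  then show ?case
    using vars_mult[of "subst_poly F p" "subst_poly F q"] by (auto simp: subst_poly_mult)
qed (use assms(2) in simp_all)

subsection \<open>Composition and linear maps\<close>

text \<open>Substitution is contravariant: both sides are algebra homomorphisms with the same values
  on the variables below \<open>dim_vec F\<close>.\<close>

lemma subst_poly_comp:
  assumes "vars p \<subseteq> {..<dim_vec F}"
  shows "subst_poly (poly_map_comp F G) p = subst_poly G (subst_poly F p)"
  using assms
  by (induction p rule: mpoly_vars_induct)
    (simp_all add: poly_map_comp_def subst_poly_add subst_poly_mult)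

lemma subst_poly_id:
  assumes "vars p \<subseteq> {..<n}"
  shows "subst_poly (poly_map_id n) p = p"
  using assms
  by (induction p rule: mpoly_vars_induct)
    (simp_all add: poly_map_id_def subst_poly_add subst_poly_mult)

lemma dim_vec_linear_map [simp]: "dim_vec (linear_map A) = dim_row A"
  by (simp add: linear_map_def)

lemma dim_vec_poly_map_comp [simp]: "dim_vec (poly_map_comp F G) = dim_vec F"
  by (simp add: poly_map_comp_def)

lemma vars_linear_map:
  assumes "i < dim_row A"
  shows "vars (linear_map A $ i) \<subseteq> {..<dim_col A}"
proof -
  have "vars (Const c * Var j :: 'a mpoly) \<subseteq> {j}" for c j
    using vars_mult[of "Const c" "Var j :: 'a mpoly"] by simp
  then show ?thesis
    using assms vars_sum[of "\<lambda>j. Const (A $$ (i, j)) * Var j" "{..<dim_col A}"]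
    by (fastforce simp: linear_map_def)
qed

lemma linear_map_mult:
  assumes "dim_col A = dim_row B"
  shows "poly_map_comp (linear_map A) (linear_map B) = linear_map (A * B)"
proof (rule eq_vecI)
  fix i assume "i < dim_vec (linear_map (A * B))"
  then have i: "i < dim_row A"
    by simp
  have "poly_map_comp (linear_map A) (linear_map B) $ i =
      (\<Sum>j<dim_row B. \<Sum>k<dim_col B. Const (A $$ (i, j) * B $$ (j, k)) * Var k)"
    using i assms by (simp add: poly_map_comp_def linear_map_def subst_poly_sum subst_poly_mult
        sum_distrib_left Const_mult mult.assoc)
  also have "\<dots> = (\<Sum>k<dim_col B. Const (\<Sum>j<dim_row B. A $$ (i, j) * B $$ (j, k)) * Var k)"
    by (subst sum.swap) (simp add: Const_sum sum_distrib_right)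
  also have "\<dots> = linear_map (A * B) $ i"
    using i assms by (simp add: linear_map_def scalar_prod_def atLeast0LessThan)
  finally show "poly_map_comp (linear_map A) (linear_map B) $ i = linear_map (A * B) $ i" .
qed simp

lemma linear_map_one: "linear_map (1\<^sub>m n) = poly_map_id n"
proof (rule eq_vecI)
  fix i assume "i < dim_vec (poly_map_id n :: 'a mpoly vec)"
  then have i: "i < n"
    by (simp add: poly_map_id_def)
  moreover have "Const (if i = j then 1 else 0) * Var j = (if i = j then Var j else 0 :: 'a mpoly)" for j
    by simp
  ultimately show "linear_map (1\<^sub>m n) $ i = (poly_map_id n :: 'a mpoly vec) $ i"
    by (simp add: linear_map_def poly_map_id_def)
qed (simp add: poly_map_id_def)

subsection \<open>The difference operator\<close>

definition diff_op :: "'a::comm_ring_1 mpoly vec \<Rightarrow> 'a mpoly \<Rightarrow> 'a mpoly" where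
  "diff_op F p = subst_poly F p - p"

lemma P_poly_eq_funpow: "P_poly F i k = (diff_op F ^^ k) (Var i)"
  by (induction k) (simp_all add: diff_op_def)

lemma diff_op_0 [simp]: "diff_op F 0 = 0"
  by (simp add: diff_op_def)

lemma diff_op_funpow_0 [simp]: "(diff_op F ^^ k) 0 = 0"
  by (induction k) simp_all

lemma diff_op_funpow_add: "(diff_op F ^^ k) (p + q) = (diff_op F ^^ k) p + (diff_op F ^^ k) q"
  by (induction k) (simp_all add: diff_op_def subst_poly_add)

text \<open>The operator is a polynomial in substitution by \<open>F\<close>, so the two commute.
  Hence \<open>subst_poly F p\<close> is annihilated by every power that annihilates
  \<open>p\<close>.\<close>

lemma diff_op_funpow_subst_poly:
  "(diff_op F ^^ k) (subst_poly F p) = subst_poly F ((diff_op F ^^ k) p)"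
  by (induction k) (simp_all add: diff_op_def subst_poly_diff)

lemma diff_op_mult: "diff_op F (p * q) = diff_op F p * q + subst_poly F p * diff_op F q"
  by (simp add: diff_op_def subst_poly_mult algebra_simps)

lemma diff_op_funpow_eq_0_mono:
  assumes "(diff_op F ^^ a) p = 0" "a \<le> b"
  shows "(diff_op F ^^ b) p = 0"
proof -
  have "b = (b - a) + a"
    using assms(2) by simp
  then have "(diff_op F ^^ b) p = (diff_op F ^^ (b - a)) ((diff_op F ^^ a) p)"
    by (metis comp_apply funpow_add)
  then show ?thesis
    using assms(1) by simp
qed

text \<open>Induction on the total exponent: the twisted Leibniz rule spends one application on one
  of the two factors.\<close>

lemma diff_op_funpow_mult_eq_0:
  assumes "(diff_op F ^^ a) p = 0" "(diff_op F ^^ b) q = 0"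
  shows "(diff_op F ^^ (a + b)) (p * q) = 0"
  using assms
proof (induction "a + b" arbitrary: a b p q)
  case 0
  then show ?case by simp
next
  case (Suc k)
  show ?case
  \<comment> \<open>A zero exponent means that the factor itself is 0.\<close>
  proof (cases "a = 0 \<or> b = 0")
    case True
    then show ?thesis
      using Suc.prems by auto
  next
    case False
    then obtain a' b' where a': "a = Suc a'" and b': "b = Suc b'"
      by (metis not0_implies_Suc)
    \<comment> \<open>In each Leibniz summand the differentiated factor dies one power earlier,
      while the other factor keeps its exponent; both totals are \<open>k\<close>.\<close>
    have "(diff_op F ^^ (a' + b)) (diff_op F p * q) = 0"
      using Suc.hyps(2) Suc.prems by (intro Suc.hyps(1)) (simp_all add: a' funpow_swap1)
    moreover have "(diff_op F ^^ (a + b')) (subst_poly F p * diff_op F q) = 0"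
      using Suc.hyps(2) Suc.prems
      by (intro Suc.hyps(1)) (simp_all add: b' funpow_swap1 diff_op_funpow_subst_poly)
    moreover have "a' + b = k" "a + b' = k"
      using Suc.hyps(2) by (simp_all add: a' b')
    moreover have "(diff_op F ^^ (a + b)) (p * q) = (diff_op F ^^ k) (diff_op F (p * q))"
      by (simp add: funpow_swap1 flip: Suc.hyps(2))
    ultimately show ?thesis
      by (simp add: diff_op_mult diff_op_funpow_add)
  qed
qed

section \<open>Local nilpotency of the difference operator\<close>

definition locally_nilpotent_at :: "'a::comm_ring_1 mpoly vec \<Rightarrow> 'a mpoly \<Rightarrow> bool" where
  "locally_nilpotent_at F p \<longleftrightarrow> (\<exists>k. (diff_op F ^^ k) p = 0)"

lemma locally_nilpotent_at_vars:
  assumes "vars p \<subseteq> V" "\<And>i. i \<in> V \<Longrightarrow> locally_nilpotent_at F (Var i)"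
  shows "locally_nilpotent_at F p"
  using assms(1)
proof (induction p rule: mpoly_vars_induct)
  case (Const c)
  have "(diff_op F ^^ 1) (Const c) = 0"
    by (simp add: diff_op_def)
  then show ?case
    unfolding locally_nilpotent_at_def by blast
next
  case (Var i)
  then show ?case
    by (rule assms(2))
next
  case (add p q)
  then obtain a b where "(diff_op F ^^ a) p = 0" "(diff_op F ^^ b) q = 0"
    by (auto simp: locally_nilpotent_at_def)
  then have "(diff_op F ^^ max a b) (p + q) = 0"
    by (simp add: diff_op_funpow_add diff_op_funpow_eq_0_mono)
  then show ?case
    unfolding locally_nilpotent_at_def by blast
next
  case (mult p q)
  then show ?case
    unfolding locally_nilpotent_at_def by (blast intro: diff_op_funpow_mult_eq_0)
qed

text \<open>Descending induction on \<open>i\<close>, run as strong induction on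
  \<open>n - i\<close>: the increment of \<open>Var i\<close> is a polynomial in later variables,
  where local nilpotency is already known.\<close>

lemma triangular_locally_nilpotent_at_Var:
  assumes "triangular n G" "i < n"
  shows "locally_nilpotent_at G (Var i)"
  using assms(2)
proof (induction "n - i" arbitrary: i rule: less_induct)
  case less
  obtain H where H: "vars H \<subseteq> {i<..<n}" "G $ i = Var i + H"
  proof (cases "i + 1 < n")
    case True
    then show thesis
      using assms(1) that by (auto simp: triangular_def)
  next
    case False
    then have "i = n - 1"
      using less.prems by simp
    then show thesis
      \<comment> \<open>The last component is the bare variable, so its tail is 0.\<close>
      using assms(1) that[of 0] by (simp add: triangular_def vars_def)
  qed
  have "locally_nilpotent_at G H"
    using H(1) by (rule locally_nilpotent_at_vars) (use less in auto)
  then obtain k where "(diff_op G ^^ k) H = 0"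
    by (auto simp: locally_nilpotent_at_def)
  then have "(diff_op G ^^ Suc k) (Var i) = 0"
    by (simp add: funpow_swap1 diff_op_def[of G "Var i"] H(2))
  then show ?case
    unfolding locally_nilpotent_at_def by blast
qed

text \<open>Substitution by \<open>S\<close> turns \<open>diff_op G\<close> into
  \<open>diff_op F\<close>. The induction peels off the innermost application, so
  \<open>diff_op G p\<close> must again use only the first \<open>n\<close> variables.\<close>

lemma diff_op_funpow_intertwine:
  assumes "\<And>p. vars p \<subseteq> {..<n} \<Longrightarrow> subst_poly F (subst_poly S p) = subst_poly S (subst_poly G p)"
    and "\<And>i. i < n \<Longrightarrow> vars (G $ i) \<subseteq> {..<n}"
    and "vars p \<subseteq> {..<n}"
  shows "(diff_op F ^^ k) (subst_poly S p) = subst_poly S ((diff_op G ^^ k) p)"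
  using assms(3)
proof (induction k arbitrary: p)
  case (Suc k)
  have "vars (subst_poly G p) \<subseteq> {..<n}"
    using Suc.prems assms(2) by (rule vars_subst_poly) auto
  then have "vars (diff_op G p) \<subseteq> {..<n}"
    using Suc.prems vars_diff[of "subst_poly G p" p] by (auto simp: diff_op_def)
  moreover have "diff_op F (subst_poly S p) = subst_poly S (diff_op G p)"
    by (simp add: diff_op_def subst_poly_diff assms(1) Suc.prems)
  ultimately show ?case
    by (simp add: funpow_Suc_right Suc.IH del: funpow.simps)
qed simp

theorem corollary5:
  fixes F :: "'a::field_char_0 mpoly vec" and n :: nat
  assumes "n \<ge> 1"
    and "polynomial_automorphism n F"
    and "triangulable n F"
  shows "nice n F"
proof -
  obtain A B where AB: "A \<in> carrier_mat n n" "B \<in> carrier_mat n n" "inverts_mat A B"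
    and tri: "triangular n (poly_map_comp (linear_map B) (poly_map_comp F (linear_map A)))"
    using assms(3) by (auto simp: triangulable_def)
  define S T G where "S = linear_map B" and "T = linear_map A"
    and "G = poly_map_comp S (poly_map_comp F T)"
  have dim: "dim_vec S = n" "dim_vec T = n" "dim_vec F = n"
    and vars_F: "\<And>i. i < n \<Longrightarrow> vars (F $ i) \<subseteq> {..<n}"
    using AB assms(2)
    by (auto simp: S_def T_def polynomial_automorphism_def polynomial_map_def)
  have vars_S: "vars (S $ i) \<subseteq> {..<n}" and vars_T: "vars (T $ i) \<subseteq> {..<n}" if "i < n" for i
    using vars_linear_map[of i B] vars_linear_map[of i A] AB that by (auto simp: S_def T_def)
  \<comment> \<open>Only this order of the inverse pair is used: it makes substituting
    \<open>T\<close> and then \<open>S\<close> the identity.\<close>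
  have "poly_map_comp T S = poly_map_id n"
    using AB by (simp add: S_def T_def linear_map_mult inverts_mat_def linear_map_one)
  then have ST: "subst_poly S (subst_poly T p) = p" if "vars p \<subseteq> {..<n}" for p
    using that subst_poly_comp[of p T S] by (simp add: dim subst_poly_id)
  have vars_FS: "vars (subst_poly F (S $ i)) \<subseteq> {..<n}" if "i < n" for i
    using vars_S[OF that] vars_F by (rule vars_subst_poly) auto
  have G: "G $ i = subst_poly T (subst_poly F (S $ i))" if "i < n" for i
    using that vars_S[OF that] by (simp add: G_def poly_map_comp_def[of S] dim subst_poly_comp)
  have vars_G: "vars (G $ i) \<subseteq> {..<n}" if "i < n" for i
    unfolding G[OF that] using vars_FS[OF that] vars_T by (rule vars_subst_poly) auto
  \<comment> \<open>On a variable, \<open>G\<close> unfolds to substitution of \<open>T\<close> into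
    \<open>subst_poly F (S $ i)\<close>; \<open>S\<close> then undoes \<open>T\<close>, as
    \<open>vars_FS\<close> keeps that polynomial in the first \<open>n\<close> variables.\<close>
  have FS: "subst_poly F (subst_poly S p) = subst_poly S (subst_poly G p)"
    if "vars p \<subseteq> {..<n}" for p
    using that
    by (induction p rule: mpoly_vars_induct)
      (simp_all add: subst_poly_add subst_poly_mult G ST vars_FS)
  have "\<exists>k. P_poly F i k = 0" if "i < n" for i
  proof -
    \<comment> \<open>The linear form \<open>T $ i\<close> is chosen because substituting
      \<open>S\<close> into it gives \<open>Var i\<close>; its annihilating power for
      \<open>G\<close> thus works for \<open>Var i\<close> and \<open>F\<close>.\<close>
    have "locally_nilpotent_at G (T $ i)"
      using vars_T[OF that]
      by (rule locally_nilpotent_at_vars)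
        (use tri in \<open>auto simp: G_def S_def T_def intro: triangular_locally_nilpotent_at_Var\<close>)
    then obtain k where k: "(diff_op G ^^ k) (T $ i) = 0"
      by (auto simp: locally_nilpotent_at_def)
    have "subst_poly S (T $ i) = Var i"
      using ST[of "Var i"] that by simp
    then have "P_poly F i k = subst_poly S ((diff_op G ^^ k) (T $ i))"
      using diff_op_funpow_intertwine[OF FS vars_G vars_T[OF that], of k]
      by (simp add: P_poly_eq_funpow)
    then show ?thesis
      using k by auto
  qed
  then obtain k where k: "\<And>i. i < n \<Longrightarrow> (diff_op F ^^ k i) (Var i) = 0"
    unfolding P_poly_eq_funpow by metis
  \<comment> \<open>Niceness asks for one exponent for all \<open>i\<close>; the sum dominates each
    \<open>k i\<close>, and vanishing persists for larger exponents.\<close>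
  have "P_poly F i (\<Sum>i<n. k i) = 0" if "i < n" for i
    unfolding P_poly_eq_funpow
    by (rule diff_op_funpow_eq_0_mono[OF k[OF that]]) (use that in \<open>auto intro: member_le_sum\<close>)
  then show ?thesis
    unfolding nice_def by blast
qed

end
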